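(* Let $G=(V,E)$ be a strongly regular graph with parameters $(v,k,\lambda,\mu)$ and $(0,1)$ adjacency matrix eigenvalues $k>\theta_1>\theta_2$, and suppose $v=2(k-\theta_1)$. Let $E_2$ be the orthogonal projection onto the $\theta_2$-eigenspace of the adjacency matrix, with rank $m_2$. If there is a subset $H\subset V$ such that the switched graph $S(G,H)$ is a strongly regular graph with parameters different from $(v,k,\lambda,\mu)$, then the spherical embedding of $V$ with respect to $E_2$ lies on two parallel hyperplanes (of dimension at most $m_2-1$).
   Context: A strongly regular graph with parameters $(v,k,\lambda,\mu)$ has $v$ vertices, is $k$-regular, adjacent vertices have $\lambda$ common neighbours and distinct nonadjacent vertices have $\mu$ common neighbours. For $H\subseteq V$, $S(G,H)$ is the graph on $V$ obtained by interchanging adjacency and nonadjacency between $H$ and $V\setminus H$, keeping all other adjacencies. The spherical embedding of $V$ with respect to $E_2$ sends $x\in V$ to $\sqrt{v/m_2}\,E_2e_x$, a point of the unit sphere in the $m_2$-dimensional column space of $E_2$, where $e_x$ is the standard basis vector indexed by $x$. *)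

theory Defs
  imports "HOL-Analysis.Analysis"
begin

text \<open>A finite simple graph is given by its adjacency relation; the vertex set is the
  (finite) type \<open>'v\<close>.\<close>

definition simple_graph :: "('v \<Rightarrow> 'v \<Rightarrow> bool) \<Rightarrow> bool" where
  "simple_graph adj \<longleftrightarrow> symp adj \<and> irreflp adj"

text \<open>Complete and edgeless graphs are not excluded here; for them \<open>m\<close> or \<open>l\<close> is arbitrary.\<close>

definition strongly_regular ::
    "('v::finite \<Rightarrow> 'v \<Rightarrow> bool) \<Rightarrow> nat \<Rightarrow> nat \<Rightarrow> nat \<Rightarrow> nat \<Rightarrow> bool" where
  "strongly_regular adj v k l m \<longleftrightarrow>
     simple_graph adj \<and>
     CARD('v) = v \<and>
     (\<forall>x. card {y. adj x y} = k) \<and>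
     (\<forall>x y. adj x y \<longrightarrow> card {z. adj x z \<and> adj y z} = l) \<and>
     (\<forall>x y. x \<noteq> y \<and> \<not> adj x y \<longrightarrow> card {z. adj x z \<and> adj y z} = m)"

definition switched_graph :: "('v \<Rightarrow> 'v \<Rightarrow> bool) \<Rightarrow> 'v set \<Rightarrow> 'v \<Rightarrow> 'v \<Rightarrow> bool" where
  "switched_graph adj H x y \<longleftrightarrow>
     (if x \<in> H \<longleftrightarrow> y \<in> H then adj x y else \<not> adj x y)"

definition adjacency_matrix :: "('v::finite \<Rightarrow> 'v \<Rightarrow> bool) \<Rightarrow> real ^ 'v ^ 'v" where
  "adjacency_matrix adj = (\<chi> x y. if adj x y then 1 else 0)"

definition eigenspace :: "real ^ 'n ^ 'n \<Rightarrow> real \<Rightarrow> (real ^ 'n) set" where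
  "eigenspace A t = {x. A *v x = t *\<^sub>R x}"

definition eigenvalues :: "real ^ 'n ^ 'n \<Rightarrow> real set" where
  "eigenvalues A = {t. \<exists>x. x \<noteq> 0 \<and> A *v x = t *\<^sub>R x}"

definition is_orthogonal_projection :: "real ^ 'n ^ 'n \<Rightarrow> (real ^ 'n) set \<Rightarrow> bool" where
  "is_orthogonal_projection P U \<longleftrightarrow>
     (\<forall>x. P *v x \<in> U \<and> (\<forall>u\<in>U. (x - P *v x) \<bullet> u = 0))"

definition column_space :: "real ^ 'n ^ 'm \<Rightarrow> (real ^ 'm) set" where
  "column_space A = span (columns A)"

definition spherical_embedding :: "real ^ 'v ^ 'v \<Rightarrow> 'v::finite \<Rightarrow> real ^ 'v" where
  "spherical_embedding P x = sqrt (real CARD('v) / real (rank P)) *\<^sub>R (P *v axis x 1)"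

text \<open>An affine hyperplane of the subspace \<open>U\<close>. The normal vector is taken in \<open>U\<close>, so that the
  level set has codimension one in \<open>U\<close>, rather than in the surrounding space.\<close>

definition hyperplane_in :: "'a::euclidean_space set \<Rightarrow> 'a set \<Rightarrow> bool" where
  "hyperplane_in U P \<longleftrightarrow> (\<exists>a\<in>U. a \<noteq> 0 \<and> (\<exists>b. P = {y \<in> U. a \<bullet> y = b}))"

end

theory Submission
  imports Defs
begin

text \<open>Let \<open>S = J - I - 2A\<close> be the Seidel matrix. The condition \<open>v = 2(k - \<theta>1)\<close> makes the
  eigenvalue of \<open>S\<close> on the all-ones vector coincide with its eigenvalue \<open>-1 - 2\<theta>1\<close>, so that \<open>S\<close>
  satisfies a quadratic equation. Switching conjugates \<open>S\<close> by the diagonal matrix of the sign vector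
  \<open>s\<close> of \<open>H\<close>, and regularity of the switched graph says that \<open>s\<close> is an eigenvector of \<open>S\<close>. If its
  eigenvalue is \<open>-1 - 2\<theta>1\<close>, the parameters do not change. Otherwise it is \<open>-1 - 2\<theta>2\<close>; then \<open>s\<close> lies
  in the \<open>\<theta>2\<close>-eigenspace of \<open>A\<close>, and \<open>s \<bullet> E2 e\<^sub>x = s \<bullet> e\<^sub>x = \<plusminus>1\<close> for every vertex \<open>x\<close>.\<close>

section \<open>Seidel matrices\<close>

definition seidel :: "('v \<Rightarrow> 'v \<Rightarrow> bool) \<Rightarrow> 'v \<Rightarrow> 'v \<Rightarrow> real" where
  "seidel adj x y = (if x = y then 0 else if adj x y then -1 else 1)"

definition switching_sign :: "'v set \<Rightarrow> 'v \<Rightarrow> real" where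
  "switching_sign H x = (if x \<in> H then -1 else 1)"

lemma switching_sign_square [simp]: "switching_sign H x * switching_sign H x = 1"
  by (simp add: switching_sign_def)

text \<open>The product of the two signs is -1 exactly for pairs separated by \<open>H\<close>, the
  pairs whose adjacency is interchanged; none of these is on the diagonal.\<close>

lemma seidel_switched:
  "seidel (switched_graph adj H) x y = switching_sign H x * switching_sign H y * seidel adj x y"
  by (auto simp: seidel_def switched_graph_def switching_sign_def)

lemma seidel_sym: "simple_graph adj \<Longrightarrow> seidel adj x y = seidel adj y x"
  by (auto simp: seidel_def simple_graph_def symp_def)

lemma seidel_eq:
  assumes "simple_graph adj"
  shows "seidel adj x y = 1 - of_bool (x = y) - 2 * of_bool (adj x y)"
  using assms by (auto simp: seidel_def simple_graph_def irreflp_def)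

lemma sum_of_bool: "(\<Sum>x\<in>(UNIV::'v::finite set). of_bool (P x)) = (of_nat (card {x. P x}) :: real)"
proof -
  have "(\<Sum>x\<in>(UNIV::'v set). of_bool (P x) :: real) = (\<Sum>x\<in>UNIV. if x \<in> {x. P x} then 1 else 0)"
    by (intro sum.cong) auto
  also have "\<dots> = of_nat (card {x. P x})" by (subst sum.inter_restrict[symmetric]) auto
  finally show ?thesis .
qed

lemma sum_of_bool_eq_mult:
  fixes f :: "'v::finite \<Rightarrow> real"
  shows "(\<Sum>z\<in>UNIV. of_bool (x = z) * f z) = f x"
proof -
  have "(\<Sum>z\<in>UNIV. of_bool (x = z) * f z) = (\<Sum>z\<in>UNIV. if x = z then f z else 0)"
    by (intro sum.cong) auto
  then show ?thesis by simp
qed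

lemma sum_seidel:
  fixes adj :: "'v::finite \<Rightarrow> 'v \<Rightarrow> bool"
  assumes "strongly_regular adj v k l m"
  shows "(\<Sum>y\<in>UNIV. seidel adj x y) = real v - 1 - 2 * real k"
proof -
  have sg: "simple_graph adj" and c: "CARD('v) = v" and d: "card {y. adj x y} = k"
    using assms by (auto simp: strongly_regular_def)
  have e: "(\<Sum>y\<in>UNIV. of_bool (x = y)) = (1::real)"
    using sum_of_bool_eq_mult[of x "\<lambda>_. 1"] by simp
  show ?thesis
    by (simp add: seidel_eq[OF sg] sum_subtractf sum_distrib_left[symmetric] sum_of_bool d c e del: sum_of_bool_eq of_bool_eq_iff)
qed

lemma seidel_square_off_diagonal:
  fixes adj :: "'v::finite \<Rightarrow> 'v \<Rightarrow> bool"
  assumes srg: "strongly_regular adj v k l m" and "x \<noteq> y"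
  shows "(\<Sum>z\<in>UNIV. seidel adj x z * seidel adj z y) =
    (if adj x y then real v + 2 - 4 * real k + 4 * real l else real v - 2 - 4 * real k + 4 * real m)"
proof -
  have sg: "simple_graph adj" and c: "CARD('v) = v" and d: "card {z. adj u z} = k" for u
    using srg by (auto simp: strongly_regular_def)
  have sym: "adj y x = adj x y" and irr: "\<not> adj u u" for u
    using sg by (auto simp: simple_graph_def symp_def irreflp_def)
  have common: "card {z. adj x z \<and> adj y z} = (if adj x y then l else m)"
    using srg \<open>x \<noteq> y\<close> by (auto simp: strongly_regular_def)
  have e: "(\<Sum>z\<in>UNIV. of_bool (u = z)) = (1::real)" for u :: 'v
    using sum_of_bool_eq_mult[of u "\<lambda>_. 1"] by simp
  \<comment> \<open>Expansion of \<open>(J - I - 2A)^2\<close>. Indicator products vanish for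
    \<open>z = x\<close> with \<open>z = y\<close>, since \<open>x \<noteq> y\<close>, and for
    \<open>z = x\<close> with \<open>adj x z\<close>, by irreflexivity. The corrections at
    \<open>z = x\<close> and \<open>z = y\<close> each contribute
    \<open>2 * of_bool (adj x y)\<close>.\<close>
  have "(\<Sum>z\<in>UNIV. seidel adj x z * seidel adj z y) =
      (\<Sum>z\<in>UNIV. 1 - of_bool (x = z) - of_bool (y = z) - 2 * of_bool (adj x z) - 2 * of_bool (adj y z)
         + of_bool (x = z) * (2 * of_bool (adj y z)) + of_bool (y = z) * (2 * of_bool (adj x z))
         + 4 * of_bool (adj x z \<and> adj y z))"
    using \<open>x \<noteq> y\<close> by (intro sum.cong refl) (subst seidel_sym[OF sg, of _ y], auto simp: seidel_eq[OF sg] irr)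
  also have "\<dots> = real v - 2 - 4 * real k + 4 * of_bool (adj x y) + 4 * real (card {z. adj x z \<and> adj y z})"
    unfolding sum_subtractf sum.distrib sum_distrib_left[symmetric] sum_of_bool_eq_mult e
      sum_of_bool d sym
    by (simp add: c)
  finally show ?thesis by (simp add: common)
qed

lemma seidel_square_diagonal:
  fixes adj :: "'v::finite \<Rightarrow> 'v \<Rightarrow> bool"
  assumes "simple_graph adj"
  shows "(\<Sum>z\<in>UNIV. seidel adj x z * seidel adj z x) = real CARD('v) - 1"
proof -
  have "(\<Sum>z\<in>UNIV. seidel adj x z * seidel adj z x) = (\<Sum>z\<in>UNIV. 1 - of_bool (x = z) * 1)"
    by (intro sum.cong refl) (subst seidel_sym[OF assms, of _ x], simp add: seidel_def)
  then show ?thesis by (simp only: sum_subtractf sum_of_bool_eq_mult) simp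
qed

text \<open>The hypothesis on \<open>v\<close> makes the two off-diagonal values of the square
  opposite, so both are the same multiple of the Seidel entry. This is the quadratic equation of a
  regular two-graph.\<close>

lemma seidel_square:
  fixes adj :: "'v::finite \<Rightarrow> 'v \<Rightarrow> bool"
  assumes srg: "strongly_regular adj v k l m" and v: "real v = 4 * real k - 2 * real l - 2 * real m"
  shows "(\<Sum>z\<in>UNIV. seidel adj x z * seidel adj z y) =
    (2 * real m - 2 * real l - 2) * seidel adj x y + (real v - 1) * of_bool (x = y)"
proof (cases "x = y")
  case True
  then show ?thesis
    using srg seidel_square_diagonal[of adj x] by (simp add: strongly_regular_def seidel_def)
next
  case False
  then show ?thesis
    unfolding seidel_square_off_diagonal[OF srg False] using v by (simp add: seidel_def)
qed

text \<open>The square of the Seidel matrix is applied to \<open>f\<close> in two ways, by the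
  eigenvalue equation and by the quadratic equation; \<open>f z\<close> then cancels.\<close>

lemma seidel_eigenvalue:
  fixes adj :: "'v::finite \<Rightarrow> 'v \<Rightarrow> bool"
  assumes srg: "strongly_regular adj v k l m" and v: "real v = 4 * real k - 2 * real l - 2 * real m"
    and eig: "\<And>x. (\<Sum>y\<in>UNIV. seidel adj x y * f y) = c * f x" and "f z \<noteq> 0"
  shows "c * c = (2 * real m - 2 * real l - 2) * c + real v - 1"
proof -
  let ?r = "2 * real m - 2 * real l - 2"
  have "c * c * f z = c * (\<Sum>y\<in>UNIV. seidel adj z y * f y)"
    by (simp add: eig)
  also have "\<dots> = (\<Sum>y\<in>UNIV. seidel adj z y * (c * f y))"
    by (simp only: sum_distrib_left mult.left_commute[of c])
  also have "\<dots> = (\<Sum>y\<in>UNIV. seidel adj z y * (\<Sum>w\<in>UNIV. seidel adj y w * f w))"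
    by (simp only: eig)
  also have "\<dots> = (\<Sum>w\<in>UNIV. (\<Sum>y\<in>UNIV. seidel adj z y * seidel adj y w) * f w)"
    unfolding sum_distrib_left sum_distrib_right by (subst sum.swap) (simp add: mult_ac)
  also have "\<dots> = (\<Sum>w\<in>UNIV. ?r * (seidel adj z w * f w) + of_bool (z = w) * ((real v - 1) * f w))"
    by (intro sum.cong refl) (simp only: seidel_square[OF srg v], simp add: algebra_simps)
  also have "\<dots> = (?r * c + real v - 1) * f z"
    unfolding sum.distrib sum_of_bool_eq_mult sum_distrib_left[symmetric] eig
    by (simp add: algebra_simps)
  finally show ?thesis using \<open>f z \<noteq> 0\<close> by simp
qed

section \<open>Eigenvalues of a strongly regular graph\<close>

lemma adjacency_matrix_mult:
  "(adjacency_matrix adj *v u) $ x = (\<Sum>y\<in>UNIV. of_bool (adj x y) * u $ y)"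
  by (simp add: adjacency_matrix_def matrix_vector_mult_def of_bool_def)

text \<open>Entrywise form of \<open>A^2 = k I + l A + m (J - I - A)\<close>, obtained by counting
  walks of length two.\<close>

lemma adjacency_square:
  fixes adj :: "'v::finite \<Rightarrow> 'v \<Rightarrow> bool"
  assumes srg: "strongly_regular adj v k l m"
  shows "(\<Sum>z\<in>UNIV. of_bool (adj x z) * of_bool (adj z y)) =
    (real k - real m) * of_bool (x = y) + (real l - real m) * of_bool (adj x y) + real m"
proof -
  have sg: "simple_graph adj" using srg by (simp add: strongly_regular_def)
  have sym: "adj z y = adj y z" for z using sg by (auto simp: simple_graph_def symp_def)
  have "(\<Sum>z\<in>UNIV. of_bool (adj x z) * of_bool (adj z y)) = (\<Sum>z\<in>UNIV. of_bool (adj x z \<and> adj y z) :: real)"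
    by (intro sum.cong refl) (simp add: sym)
  also have "\<dots> = real (card {z. adj x z \<and> adj y z})" by (rule sum_of_bool)
  finally show ?thesis
    using srg by (auto simp: strongly_regular_def simple_graph_def irreflp_def)
qed

text \<open>The final sum is the contribution of \<open>J\<close>. It is kept so that the lemma
  serves both the all-ones vector and eigenvectors with sum zero.\<close>

lemma adjacency_square_mult:
  fixes adj :: "'v::finite \<Rightarrow> 'v \<Rightarrow> bool" and u :: "'v \<Rightarrow> real"
  assumes srg: "strongly_regular adj v k l m"
    and eig: "\<And>x. (\<Sum>y\<in>UNIV. of_bool (adj x y) * u y) = t * u x"
  shows "t * t * u x = (real k - real m) * u x + (real l - real m) * t * u x + real m * (\<Sum>y\<in>UNIV. u y)"
proof -
  have "t * t * u x = (\<Sum>z\<in>UNIV. of_bool (adj x z) * (\<Sum>y\<in>UNIV. of_bool (adj z y) * u y))"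
    using eig[of x] by (simp add: eig sum_distrib_left[symmetric] mult.left_commute)
  also have "\<dots> = (\<Sum>y\<in>UNIV. (\<Sum>z\<in>UNIV. of_bool (adj x z) * of_bool (adj z y)) * u y)"
    unfolding sum_distrib_left sum_distrib_right by (subst sum.swap) (simp add: mult_ac)
  also have "\<dots> = (\<Sum>y\<in>UNIV. of_bool (x = y) * ((real k - real m) * u y) +
      (real l - real m) * (of_bool (adj x y) * u y) + real m * u y)"
    by (intro sum.cong refl) (simp only: adjacency_square[OF srg], simp add: algebra_simps)
  also have "\<dots> = (real k - real m) * u x + (real l - real m) * t * u x + real m * (\<Sum>y\<in>UNIV. u y)"
    unfolding sum.distrib sum_of_bool_eq_mult sum_distrib_left[symmetric] eig by simp
  finally show ?thesis .
qed

text \<open>Moving \<open>K\<close> across the inner product multiplies it by \<open>a\<close> on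
  one side and by \<open>b\<close> on the other. A general kernel covers both adjacency and Seidel
  matrices.\<close>

lemma symmetric_eigenvectors_orthogonal:
  fixes K :: "'v::finite \<Rightarrow> 'v \<Rightarrow> real"
  assumes sym: "\<And>x y. K x y = K y x"
    and f: "\<And>x. (\<Sum>y\<in>UNIV. K x y * f y) = a * f x"
    and g: "\<And>x. (\<Sum>y\<in>UNIV. K x y * g y) = b * g x"
    and "a \<noteq> b"
  shows "(\<Sum>x\<in>UNIV. f x * g x) = 0"
proof -
  have "a * (\<Sum>x\<in>UNIV. f x * g x) = (\<Sum>x\<in>UNIV. (\<Sum>y\<in>UNIV. K x y * f y) * g x)"
    by (simp only: f sum_distrib_left mult.assoc)
  also have "\<dots> = (\<Sum>y\<in>UNIV. f y * (\<Sum>x\<in>UNIV. K y x * g x))"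
    unfolding sum_distrib_left sum_distrib_right by (subst sum.swap) (simp add: mult_ac sym[of x y for x y])
  also have "\<dots> = b * (\<Sum>x\<in>UNIV. f x * g x)"
    by (simp only: g sum_distrib_left mult.left_commute[of b])
  finally show ?thesis using \<open>a \<noteq> b\<close> by simp
qed

text \<open>The all-ones vector is an eigenvector for \<open>k\<close>. Rearranged, this is the
  familiar \<open>k (k - l - 1) = m (v - k - 1)\<close>.\<close>

lemma srg_parameter_identity:
  fixes adj :: "'v::finite \<Rightarrow> 'v \<Rightarrow> bool"
  assumes srg: "strongly_regular adj v k l m"
  shows "real k * real k = real k - real m + (real l - real m) * real k + real m * real v"
proof -
  have "(\<Sum>y\<in>UNIV. of_bool (adj x y) * (1::real)) = real k * 1" for x
    using srg sum_of_bool[of "adj x"] by (simp only: strongly_regular_def) simp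
  from adjacency_square_mult[OF srg this] show ?thesis
    using srg by (simp add: strongly_regular_def)
qed

lemma adjacency_eigenvector_sum_zero:
  fixes adj :: "'v::finite \<Rightarrow> 'v \<Rightarrow> bool"
  assumes srg: "strongly_regular adj v k l m"
    and u: "adjacency_matrix adj *v u = t *\<^sub>R u" and "t \<noteq> real k"
  shows "(\<Sum>x\<in>UNIV. u $ x) = 0"
proof -
  have "(\<Sum>x\<in>UNIV. u $ x * 1) = 0"
  proof (rule symmetric_eigenvectors_orthogonal)
    show "of_bool (adj x y) = (of_bool (adj y x) :: real)" for x y
      using srg by (auto simp: strongly_regular_def simple_graph_def symp_def)
    show "(\<Sum>y\<in>UNIV. of_bool (adj x y) * u $ y) = t * u $ x" for x
      using arg_cong[OF u, of "\<lambda>w. w $ x"] by (simp only: adjacency_matrix_mult) simp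
    show "(\<Sum>y\<in>UNIV. of_bool (adj x y) * (1::real)) = real k * 1" for x
      using srg sum_of_bool[of "adj x"] by (simp only: strongly_regular_def) simp
  qed fact
  then show ?thesis by simp
qed

text \<open>The eigenvector has sum zero, so \<open>J\<close> drops out of the quadratic. The last
  two claims concern edgeless and complete graphs: each allows a single value of \<open>t\<close>,
  so two distinct restricted eigenvalues rule them out.\<close>

lemma srg_restricted_eigenvalue:
  fixes adj :: "'v::finite \<Rightarrow> 'v \<Rightarrow> bool"
  assumes srg: "strongly_regular adj v k l m"
    and t: "t \<in> eigenvalues (adjacency_matrix adj)" "t \<noteq> real k"
  shows "t * t = real k - real m + (real l - real m) * t"
    and "k = 0 \<Longrightarrow> t = 0"
    and "k = v - 1 \<Longrightarrow> t = -1"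
proof -
  obtain u where "u \<noteq> 0" and u: "adjacency_matrix adj *v u = t *\<^sub>R u"
    using t by (auto simp: eigenvalues_def)
  then obtain x where x: "u $ x \<noteq> 0" by (auto simp: vec_eq_iff)
  have eig: "(\<Sum>y\<in>UNIV. of_bool (adj x y) * u $ y) = t * u $ x" for x
    using arg_cong[OF u, of "\<lambda>w. w $ x"] by (simp only: adjacency_matrix_mult) simp
  have zero: "(\<Sum>x\<in>UNIV. u $ x) = 0"
    using adjacency_eigenvector_sum_zero[OF srg u t(2)] .
  from adjacency_square_mult[OF srg eig, of x] zero
  have "t * t * u $ x = (real k - real m + (real l - real m) * t) * u $ x"
    by (simp add: algebra_simps)
  then show "t * t = real k - real m + (real l - real m) * t" using x by simp
  have deg: "card {y. adj x y} = k" and c: "CARD('v) = v" and irr: "\<not> adj x x"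
    using srg by (auto simp: strongly_regular_def simple_graph_def irreflp_def)
  show "t = 0" if "k = 0"
    using deg that eig[of x] x by simp
  show "t = -1" if "k = v - 1"
  proof -
    \<comment> \<open>Row \<open>x\<close> of \<open>A\<close> is the row of \<open>J - I\<close>,
      and \<open>J\<close> annihilates \<open>u\<close>.\<close>
    have "{y. adj x y} = UNIV - {x}"
      using irr deg that c by (intro card_subset_eq) auto
    then have "adj x y \<longleftrightarrow> y \<noteq> x" for y by blast
    then have "(\<Sum>y\<in>UNIV. of_bool (adj x y) * u $ y) = (\<Sum>y\<in>UNIV. u $ y - of_bool (x = y) * u $ y)"
      by (intro sum.cong) auto
    also have "\<dots> = - u $ x"
      unfolding sum_subtractf sum_of_bool_eq_mult zero by simp
    finally show ?thesis using eig[of x] x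
      by (metis mult_minus1 mult_right_cancel)
  qed
qed

text \<open>The two quadratics give the sum and product of \<theta>1 and \<theta>2. The parameter
  identity then reads \<open>(k - \<theta>1) (k - \<theta>2) = m v\<close>, and substituting
  \<open>v_eq\<close> lets the positive factor \<open>k - \<theta>1\<close> cancel.\<close>

lemma regular_two_graph_parameters:
  fixes adj :: "'v::finite \<Rightarrow> 'v \<Rightarrow> bool"
  assumes srg: "strongly_regular adj v k l m"
    and eigs: "\<theta>1 \<in> eigenvalues (adjacency_matrix adj)" "\<theta>2 \<in> eigenvalues (adjacency_matrix adj)"
    and ord: "real k > \<theta>1" "\<theta>1 > \<theta>2"
    and v_eq: "real v = 2 * (real k - \<theta>1)"
  shows "\<theta>2 = real k - 2 * real m"
    and "real v = 4 * real k - 2 * real l - 2 * real m"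
proof -
  have 1: "\<theta>1 * \<theta>1 = real k - real m + (real l - real m) * \<theta>1"
    and 2: "\<theta>2 * \<theta>2 = real k - real m + (real l - real m) * \<theta>2"
    using srg_restricted_eigenvalue(1)[OF srg] eigs ord by auto
  have "(\<theta>1 - \<theta>2) * (\<theta>1 + \<theta>2 - (real l - real m)) = 0"
    using 1 2 by (simp add: algebra_simps)
  then have sum: "\<theta>1 + \<theta>2 = real l - real m" using ord by simp
  have prod: "\<theta>1 * \<theta>2 = real m - real k"
    using 1 by (simp add: sum[symmetric] algebra_simps)
  have "(real k - \<theta>1) * (real k - \<theta>2) = real k * real k - (\<theta>1 + \<theta>2) * real k + \<theta>1 * \<theta>2"
    by (simp add: algebra_simps)
  also have "\<dots> = real m * real v"
    using srg_parameter_identity[OF srg] by (simp add: sum prod)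
  also have "\<dots> = (real k - \<theta>1) * (2 * real m)" by (simp add: v_eq)
  finally have "real k - \<theta>2 = 2 * real m" using ord by simp
  then show "\<theta>2 = real k - 2 * real m" by simp
  then show "real v = 4 * real k - 2 * real l - 2 * real m" using sum v_eq by simp
qed

section \<open>Strongly regular switchings\<close>

text \<open>With \<open>D\<close> the diagonal matrix of signs, regularity after switching says that
  \<open>D S D\<close> has the all-ones vector as eigenvector; multiplying by \<open>D\<close> turns
  this into a statement about \<open>S\<close> and the sign vector.\<close>

lemma seidel_switching_sign:
  fixes adj :: "'v::finite \<Rightarrow> 'v \<Rightarrow> bool"
  assumes "strongly_regular (switched_graph adj H) v k l m"
  shows "(\<Sum>y\<in>UNIV. seidel adj x y * switching_sign H y) = (real v - 1 - 2 * real k) * switching_sign H x"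
proof -
  let ?s = "switching_sign H"
  have "(real v - 1 - 2 * real k) * ?s x = ?s x * (\<Sum>y\<in>UNIV. ?s x * ?s y * seidel adj x y)"
    using sum_seidel[OF assms, of x] by (simp add: seidel_switched)
  also have "\<dots> = ?s x * ?s x * (\<Sum>y\<in>UNIV. seidel adj x y * ?s y)"
    by (simp only: sum_distrib_left mult_ac)
  finally show ?thesis by simp
qed

text \<open>Conjugation by signs preserves the quadratic equation. With \<open>v\<close> and
  \<open>k\<close> unchanged, its entries at an edge and at a nonedge determine \<open>l'\<close>
  and \<open>m'\<close>; the conditions on \<open>k\<close> supply both kinds of pair.\<close>

lemma switched_parameters_eq:
  fixes adj :: "'v::finite \<Rightarrow> 'v \<Rightarrow> bool"
  assumes srg: "strongly_regular adj v k l m" and v: "real v = 4 * real k - 2 * real l - 2 * real m"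
    and srg': "strongly_regular (switched_graph adj H) v k l' m'"
    and k: "k \<noteq> 0" "k \<noteq> v - 1"
  shows "l' = l" and "m' = m"
proof -
  let ?adj = "switched_graph adj H" and ?s = "switching_sign H"
  have deg: "card {y. ?adj x y} = k" and c: "CARD('v) = v" and irr: "\<not> ?adj x x" for x
    using srg' by (auto simp: strongly_regular_def simple_graph_def irreflp_def)
  have sq: "(\<Sum>z\<in>UNIV. seidel ?adj x z * seidel ?adj z y) = (2 * real m - 2 * real l - 2) * seidel ?adj x y"
    if "x \<noteq> y" for x y
  proof -
    \<comment> \<open>The sign of the middle vertex \<open>z\<close> occurs twice and
      cancels.\<close>
    have "(\<Sum>z\<in>UNIV. seidel ?adj x z * seidel ?adj z y) =
        (\<Sum>z\<in>UNIV. ?s x * ?s y * (seidel adj x z * seidel adj z y))"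
    proof (intro sum.cong refl)
      fix z
      have "seidel ?adj x z * seidel ?adj z y =
          (?s z * ?s z) * (?s x * ?s y * (seidel adj x z * seidel adj z y))"
        by (simp only: seidel_switched mult_ac)
      then show "seidel ?adj x z * seidel ?adj z y = ?s x * ?s y * (seidel adj x z * seidel adj z y)"
        by simp
    qed
    also have "\<dots> = (2 * real m - 2 * real l - 2) * seidel ?adj x y"
      unfolding sum_distrib_left[symmetric] seidel_square[OF srg v]
      using that by (simp add: seidel_switched)
    finally show ?thesis .
  qed
  fix x :: 'v
  have "{y. ?adj x y} \<noteq> {}" using deg[of x] k by force
  then obtain y where y: "?adj x y" by blast
  then have "x \<noteq> y" using irr by blast
  from sq[OF this] seidel_square_off_diagonal[OF srg' this] y \<open>x \<noteq> y\<close> v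
  show "l' = l" by (simp add: seidel_def)
  have "{y. ?adj x y} \<noteq> UNIV - {x}" using deg[of x] k c by force
  then obtain z where z: "\<not> ?adj x z" "x \<noteq> z" using irr by blast
  from sq[OF z(2)] seidel_square_off_diagonal[OF srg' z(2)] z v
  show "m' = m" by (simp add: seidel_def)
qed

lemma switching_sign_in_eigenspace:
  fixes adj :: "'v::finite \<Rightarrow> 'v \<Rightarrow> bool"
  assumes srg: "strongly_regular adj v k l m"
    and eigs: "\<theta>1 \<in> eigenvalues (adjacency_matrix adj)" "\<theta>2 \<in> eigenvalues (adjacency_matrix adj)"
    and ord: "real k > \<theta>1" "\<theta>1 > \<theta>2"
    and v_eq: "real v = 2 * (real k - \<theta>1)"
    and srg': "strongly_regular (switched_graph adj H) v' k' l' m'"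
    and ne: "(v', k', l', m') \<noteq> (v, k, l, m)"
  shows "(\<chi> x. switching_sign H x) \<in> eigenspace (adjacency_matrix adj) \<theta>2"
proof -
  let ?s = "switching_sign H"
  note par = regular_two_graph_parameters[OF srg eigs ord v_eq]
  have sg: "simple_graph adj" and v': "v' = v"
    using srg srg' by (auto simp: strongly_regular_def)
  have k_nontrivial: "k \<noteq> 0" "k \<noteq> v - 1"
    using srg_restricted_eigenvalue(2,3)[OF srg eigs(1)] srg_restricted_eigenvalue(2,3)[OF srg eigs(2)] ord
    by auto
  \<comment> \<open>Equal degrees would force all four parameters to agree.\<close>
  have "k' \<noteq> k"
    using switched_parameters_eq[OF srg par(2)] srg' ne k_nontrivial v' by blast
  define a where "a = real v - 1 - 2 * real k"
  define c where "c = real v - 1 - 2 * real k'"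
  have "a \<noteq> c" using \<open>k' \<noteq> k\<close> by (simp add: a_def c_def)
  have one: "(\<Sum>y\<in>UNIV. seidel adj x y * 1) = a * 1" for x
    using sum_seidel[OF srg, of x] by (simp add: a_def)
  have sign: "(\<Sum>y\<in>UNIV. seidel adj x y * ?s y) = c * ?s x" for x
    using seidel_switching_sign[OF srg', of x] by (simp add: v' c_def)
  have "a * a = (2 * real m - 2 * real l - 2) * a + real v - 1"
    using seidel_eigenvalue[OF srg par(2) one] by simp
  \<comment> \<open>Signs never vanish, so any vertex serves as witness, even
    \<open>undefined\<close>.\<close>
  moreover have "c * c = (2 * real m - 2 * real l - 2) * c + real v - 1"
    by (rule seidel_eigenvalue[OF srg par(2) sign, of undefined]) (simp add: switching_sign_def)
  ultimately have "(a - c) * (a + c - (2 * real m - 2 * real l - 2)) = 0"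
    by (simp add: algebra_simps)
  \<comment> \<open>\<open>a\<close> and \<open>c\<close> are the two distinct roots, so their sum
    is the linear coefficient; here \<open>a = -1 - 2 * \<theta>1\<close>.\<close>
  then have c: "c = -1 - 2 * \<theta>2"
    using \<open>a \<noteq> c\<close> par by (simp add: a_def)
  have "(\<Sum>x\<in>UNIV. 1 * ?s x) = 0"
    by (rule symmetric_eigenvectors_orthogonal[OF seidel_sym[OF sg] one sign \<open>a \<noteq> c\<close>])
  then have zero: "(\<Sum>x\<in>UNIV. ?s x) = 0" by simp
  have "(\<Sum>y\<in>UNIV. of_bool (adj x y) * ?s y) = \<theta>2 * ?s x" for x
  proof -
    \<comment> \<open>In \<open>J - I - 2A\<close> the term \<open>J\<close> contributes nothing,
      because the signs sum to zero.\<close>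
    have "c * ?s x = (\<Sum>y\<in>UNIV. ?s y - of_bool (x = y) * ?s y - 2 * (of_bool (adj x y) * ?s y))"
      unfolding sign[symmetric] by (intro sum.cong refl) (simp add: seidel_eq[OF sg] algebra_simps)
    also have "\<dots> = - ?s x - 2 * (\<Sum>y\<in>UNIV. of_bool (adj x y) * ?s y)"
      unfolding sum_subtractf sum_of_bool_eq_mult zero sum_distrib_left[symmetric] by simp
    finally show ?thesis by (simp add: c algebra_simps)
  qed
  then show ?thesis
    unfolding eigenspace_def by (simp only: mem_Collect_eq vec_eq_iff adjacency_matrix_mult) simp
qed

section \<open>Orthogonal projections and hyperplanes\<close>

lemma subspace_eigenspace: "subspace (eigenspace A t)"
  by (auto simp: subspace_def eigenspace_def matrix_vector_right_distrib scaleR_right_distrib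
      matrix_vector_mult_scaleR scaleR_left_commute)

text \<open>For \<open>u\<close> in \<open>U\<close>, the residual \<open>u - P *v u\<close> lies in
  \<open>U\<close> and is orthogonal to \<open>U\<close>, hence is zero. So \<open>P\<close> fixes
  \<open>U\<close> pointwise and \<open>U\<close> is its range.\<close>

lemma column_space_orthogonal_projection:
  fixes P :: "real ^ 'n ^ 'n"
  assumes P: "is_orthogonal_projection P U" and U: "subspace U"
  shows "column_space P = U"
proof -
  have fix_U: "P *v u = u" if "u \<in> U" for u
  proof -
    have "u - P *v u \<in> U" using that P U by (auto simp: is_orthogonal_projection_def intro: subspace_diff)
    then have "(u - P *v u) \<bullet> (u - P *v u) = 0" using P by (auto simp: is_orthogonal_projection_def)
    then show ?thesis by simp
  qed
  show ?thesis
    unfolding column_space_def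
  proof
    show "span (columns P) \<subseteq> U"
      using P U by (intro span_minimal) (auto simp: columns_image_basis is_orthogonal_projection_def)
    show "U \<subseteq> span (columns P)"
      using fix_U matrix_vector_mult_in_columnspace by (metis subsetI)
  qed
qed

text \<open>A multiple of the normal \<open>a\<close> translates one level to the other, and stays
  in \<open>U\<close> because \<open>a\<close> does.\<close>

lemma parallel_level_sets:
  fixes U :: "'a::euclidean_space set"
  assumes U: "subspace U" and a: "a \<in> U" "a \<noteq> 0"
  shows "affine_parallel {y \<in> U. a \<bullet> y = b} {y \<in> U. a \<bullet> y = c}"
proof -
  define w where "w = ((c - b) / (a \<bullet> a)) *\<^sub>R a"
  have w: "w \<in> U" "a \<bullet> w = c - b"
    using a U by (auto simp: w_def subspace_scale)
  have "{y \<in> U. a \<bullet> y = c} = (\<lambda>y. w + y) ` {y \<in> U. a \<bullet> y = b}"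
  proof (intro equalityI subsetI)
    fix y assume "y \<in> {y \<in> U. a \<bullet> y = c}"
    then have "y = w + (y - w)" "y - w \<in> {y \<in> U. a \<bullet> y = b}"
      using w U by (auto simp: inner_diff_right subspace_diff)
    then show "y \<in> (\<lambda>y. w + y) ` {y \<in> U. a \<bullet> y = b}" by blast
  qed (use w U in \<open>auto simp: inner_add_right subspace_add\<close>)
  then show ?thesis unfolding affine_parallel_def by blast
qed

text \<open>A nonzero level misses the origin, so it is an affine set properly contained in
  \<open>U\<close>.\<close>

lemma aff_dim_level_set:
  fixes U :: "'a::euclidean_space set"
  assumes U: "subspace U" and "b \<noteq> 0"
  shows "aff_dim {y \<in> U. a \<bullet> y = b} \<le> int (dim U) - 1"
proof -
  have eq: "{y \<in> U. a \<bullet> y = b} = U \<inter> {y. a \<bullet> y = b}" by auto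
  have "affine {y \<in> U. a \<bullet> y = b}"
    unfolding eq by (intro affine_Int subspace_imp_affine U affine_hyperplane)
  moreover have "{y \<in> U. a \<bullet> y = b} \<subset> U"
  proof -
    have "0 \<in> U" "0 \<notin> {y \<in> U. a \<bullet> y = b}"
      using subspace_0[OF U] \<open>b \<noteq> 0\<close> by simp_all
    then show ?thesis by blast
  qed
  ultimately have "aff_dim {y \<in> U. a \<bullet> y = b} < aff_dim U"
    using U by (intro aff_dim_psubset) (simp add: affine_hull_eq[THEN iffD2] subspace_imp_affine)
  then show ?thesis using aff_dim_subspace[OF U] by simp
qed

theorem theorem5p1:
  fixes adj :: "'v::finite \<Rightarrow> 'v \<Rightarrow> bool"
    and v k l m :: nat
    and \<theta>1 \<theta>2 :: real
    and E2 :: "real ^ 'v ^ 'v"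
    and H :: "'v set"
  assumes srg: "strongly_regular adj v k l m"
    and eigs: "eigenvalues (adjacency_matrix adj) = {real k, \<theta>1, \<theta>2}"
    and gt1: "real k > \<theta>1"
    and gt2: "\<theta>1 > \<theta>2"
    and v_eq: "real v = 2 * (real k - \<theta>1)"
    and proj: "is_orthogonal_projection E2 (eigenspace (adjacency_matrix adj) \<theta>2)"
    and switch: "\<exists>v' k' l' m'. strongly_regular (switched_graph adj H) v' k' l' m' \<and>
                   (v', k', l', m') \<noteq> (v, k, l, m)"
  shows "\<exists>P Q. hyperplane_in (column_space E2) P \<and> hyperplane_in (column_space E2) Q \<and>
           affine_parallel P Q \<and> P \<noteq> Q \<and>
           aff_dim P \<le> int (rank E2) - 1 \<and> aff_dim Q \<le> int (rank E2) - 1 \<and>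
           range (spherical_embedding E2) \<subseteq> P \<union> Q"
proof -
  define U where "U = eigenspace (adjacency_matrix adj) \<theta>2"
  define s :: "real ^ 'v" where "s = (\<chi> x. switching_sign H x)"
  define r where "r = sqrt (real CARD('v) / real (rank E2))"
  have U: "subspace U" unfolding U_def by (rule subspace_eigenspace)
  have s: "s \<in> U"
    using switch switching_sign_in_eigenspace[OF srg _ _ gt1 gt2 v_eq] eigs
    unfolding s_def U_def by blast
  have s_nz: "s \<noteq> 0"
    by (auto simp: s_def vec_eq_iff switching_sign_def)
  have col: "column_space E2 = U"
    using column_space_orthogonal_projection[OF proj subspace_eigenspace] by (simp add: U_def)
  have rank: "rank E2 = dim U"
    using col by (metis column_rank_def column_space_def dim_span)
  \<comment> \<open>Positive rank makes \<open>r\<close> a genuine scaling factor, not the value 0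
    that division by zero would give.\<close>
  have "dim U \<noteq> 0" using s s_nz by (auto simp: dim_eq_0)
  then have "real (dim U) > 0" by linarith
  then have r: "r > 0" unfolding r_def rank by (intro real_sqrt_gt_zero divide_pos_pos) simp_all
  \<comment> \<open>The normal is the sign vector; its entries are 1 or -1, so after scaling the
    relevant levels are \<open>r\<close> and \<open>- r\<close>.\<close>
  define P where "P b = {y \<in> U. s \<bullet> y = b}" for b
  have emb: "spherical_embedding E2 x \<in> P r \<union> P (- r)" for x
  proof -
    have E: "E2 *v axis x 1 \<in> U" "(axis x 1 - E2 *v axis x 1) \<bullet> s = 0"
      using proj s by (auto simp: is_orthogonal_projection_def U_def)
    then have "s \<bullet> (E2 *v axis x 1) = s $ x"
      by (simp add: inner_diff_left inner_axis' inner_commute[of s])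
    then have "s \<bullet> spherical_embedding E2 x = r * switching_sign H x"
      by (simp add: spherical_embedding_def r_def s_def)
    moreover have "spherical_embedding E2 x \<in> U"
      using E U by (simp add: spherical_embedding_def subspace_scale)
    ultimately show ?thesis by (simp add: P_def switching_sign_def)
  qed
  have hyp: "hyperplane_in (column_space E2) (P b)" for b
    using s s_nz unfolding hyperplane_in_def col P_def by blast
  have par: "affine_parallel (P r) (P (- r))"
    unfolding P_def by (rule parallel_level_sets[OF U s s_nz])
  \<comment> \<open>If the levels coincided, an embedded point would lie on both, against
    \<open>r > 0\<close>.\<close>
  have ne: "P r \<noteq> P (- r)"
    using emb r by (fastforce simp: P_def)
  have dim: "aff_dim (P b) \<le> int (rank E2) - 1" if "b \<noteq> 0" for b
    unfolding P_def rank by (rule aff_dim_level_set[OF U that])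
  show ?thesis
    using hyp par ne dim[of r] dim[of "- r"] r emb
    by (intro exI[of _ "P r"] exI[of _ "P (- r)"]) auto
qed

end
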